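(* Let $\mathfrak g$ be a simple Lie algebra over $\Bbbk$. For an inner periodic automorphism $\vartheta=\vartheta(\boldsymbol p)$ of $\mathfrak g$ given by Kac labels $\boldsymbol p=(p_0,p_1,\dots,p_l)$, the $\vartheta$-contraction $\mathfrak g_{(0)}$ depends only on the set $\mathcal L(\vartheta)=\{i\in\{0,1,\dots,l\}\mid p_i\ne 0\}$. That is, if $\boldsymbol p$ and $\boldsymbol p'$ are two tuples of Kac labels (with respect to the same $\mathfrak t$ and $\Pi$) such that $\{i\mid p_i\neq 0\}=\{i\mid p'_i\ne 0\}$, then the $\vartheta(\boldsymbol p)$-contraction and the $\vartheta(\boldsymbol p')$-contraction define the same Lie algebra structure on the vector space $\mathfrak g$.
   Context: $\Bbbk$ is an algebraically closed field of characteristic $0$. Kac labels of inner periodic automorphisms. Let $\mathfrak g$ be simple, $l=\operatorname{rk}\mathfrak g$, $\mathfrak t$ a Cartan subalgebra, $\Delta$ the root system, $\Pi=\{\alpha_1,\dots,\alpha_l\}$ a set of simple roots, $\mathfrak g^\gamma$ the root space of $\gamma\in\Delta$, $\delta=\sum_{i=1}^l n_i\alpha_i$ the highest root, $\alpha_0=-\delta$, $n_0=1$. Write $[\gamma:\alpha_i]$ for the coefficient of $\alpha_i$ in $\gamma$. Let $\boldsymbol p=(p_0,\dots,p_l)\ne(0,\dots,0)$ be nonnegative integers with $\gcd(p_0,\dots,p_l)=1$, and put $m=\sum_{i=0}^l n_ip_i$. The automorphism $\vartheta(\boldsymbol p)$, of order $m$, is the inner automorphism acting trivially on $\mathfrak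 t$ and as multiplication by $\zeta^{d(\gamma)}$ on $\mathfrak g^\gamma$, where $d(\gamma)=\sum_{i=1}^l[\gamma:\alpha_i]p_i$ and $\zeta$ is a fixed primitive $m$-th root of unity; every inner automorphism of finite order is conjugate to one of this form. The $p_i=p_i(\vartheta)$ are the Kac labels of $\vartheta$. Periodic contraction. Let $\vartheta$ be an automorphism of $\mathfrak g$ of order $m$, and let $\mathfrak g=\bigoplus_{i=0}^{m-1}\mathfrak g_i$, where $\mathfrak g_i$ is the $\zeta^i$-eigenspace of $\vartheta$. The $\vartheta$-contraction $\mathfrak g_{(0)}$ is the vector space $\mathfrak g$ with the Lie bracket $[\ ,\,]_{(0)}$ defined for $x\in\mathfrak g_i$, $y\in\mathfrak g_j$ ($0\le i,j\le m-1$) by $[x,y]_{(0)}=[x,y]$ if $i+j\le m-1$ and $[x,y]_{(0)}=0$ if $i+j>m-1$. *)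

theory Defs
  imports Complex_Main "HOL-Computational_Algebra.Polynomial"
begin

definition primitive_root_of_unity :: "nat \<Rightarrow> 'k::field \<Rightarrow> bool" where
  "primitive_root_of_unity m \<zeta> \<longleftrightarrow>
     0 < m \<and> \<zeta> ^ m = 1 \<and> (\<forall>k. 0 < k \<and> k < m \<longrightarrow> \<zeta> ^ k \<noteq> 1)"

definition map_order :: "('v \<Rightarrow> 'v) \<Rightarrow> nat" where
  "map_order \<theta> = (LEAST n. 0 < n \<and> \<theta> ^^ n = id)"

locale lie_algebra = vector_space scale
  for scale :: "'k::field \<Rightarrow> 'v::ab_group_add \<Rightarrow> 'v" +
  fixes br :: "'v \<Rightarrow> 'v \<Rightarrow> 'v"
  assumes br_linear_left: "Vector_Spaces.linear scale scale (\<lambda>x. br x y)"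
    and br_linear_right: "Vector_Spaces.linear scale scale (\<lambda>y. br x y)"
    and br_alternating: "br x x = 0"
    and jacobi: "br x (br y z) + br y (br z x) + br z (br x y) = 0"
begin

definition lie_ideal :: "'v set \<Rightarrow> bool" where
  "lie_ideal I \<longleftrightarrow> subspace I \<and> (\<forall>x. \<forall>y\<in>I. br x y \<in> I)"

definition lie_automorphism :: "('v \<Rightarrow> 'v) \<Rightarrow> bool" where
  "lie_automorphism \<theta> \<longleftrightarrow> Vector_Spaces.linear scale scale \<theta> \<and> bij \<theta> \<and>
     (\<forall>x y. \<theta> (br x y) = br (\<theta> x) (\<theta> y))"

definition ad_nilpotent :: "'v \<Rightarrow> bool" where
  "ad_nilpotent x \<longleftrightarrow> (\<exists>n. \<forall>y. (br x ^^ n) y = 0)"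

text \<open>The exponential series of \<open>ad x\<close>, cut off at the nilpotency index of \<open>ad x\<close>
  (only meaningful for ad-nilpotent \<open>x\<close>, in characteristic 0).\<close>

definition exp_ad :: "'v \<Rightarrow> 'v \<Rightarrow> 'v" where
  "exp_ad x y =
     (\<Sum>k < (LEAST n. \<forall>z. (br x ^^ n) z = 0). scale (inverse (of_nat (fact k))) ((br x ^^ k) y))"

text \<open>The group generated by the automorphisms \<open>exp (ad x)\<close> with \<open>ad x\<close> nilpotent; closure under
  inverses is automatic, the inverse of \<open>exp (ad x)\<close> being \<open>exp (ad (- x))\<close>.\<close>

inductive_set inner_group :: "('v \<Rightarrow> 'v) set" where
  inner_id: "id \<in> inner_group"
| inner_exp: "\<theta> \<in> inner_group \<Longrightarrow> ad_nilpotent x \<Longrightarrow> exp_ad x \<circ> \<theta> \<in> inner_group"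

definition diagonalizable :: "('v \<Rightarrow> 'v) \<Rightarrow> bool" where
  "diagonalizable f \<longleftrightarrow> span {x. \<exists>c. f x = scale c x} = UNIV"

text \<open>Cartan subalgebras in the form customary for semisimple Lie algebras over an algebraically
  closed field of characteristic 0: commutative, self-centralizing, and acting diagonalizably.\<close>

definition cartan_subalgebra :: "'v set \<Rightarrow> bool" where
  "cartan_subalgebra t \<longleftrightarrow> subspace t \<and>
     (\<forall>h\<in>t. \<forall>h'\<in>t. br h h' = 0) \<and>
     (\<forall>x. (\<forall>h\<in>t. br h x = 0) \<longrightarrow> x \<in> t) \<and>
     (\<forall>h\<in>t. diagonalizable (br h))"

text \<open>Linear functionals on \<open>t\<close>, represented by their extension by zero outside \<open>t\<close>, so that
  distinct functions are distinct functionals.\<close>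

definition dual :: "'v set \<Rightarrow> ('v \<Rightarrow> 'k) set" where
  "dual t = {\<gamma>. (\<forall>x\<in>t. \<forall>y\<in>t. \<gamma> (x + y) = \<gamma> x + \<gamma> y) \<and>
                (\<forall>c. \<forall>x\<in>t. \<gamma> (scale c x) = c * \<gamma> x) \<and>
                (\<forall>x. x \<notin> t \<longrightarrow> \<gamma> x = 0)}"

definition root_space :: "'v set \<Rightarrow> ('v \<Rightarrow> 'k) \<Rightarrow> 'v set" where
  "root_space t \<gamma> = {x. \<forall>h\<in>t. br h x = scale (\<gamma> h) x}"

definition roots :: "'v set \<Rightarrow> ('v \<Rightarrow> 'k) set" where
  "roots t = {\<gamma> \<in> dual t. \<gamma> \<noteq> (\<lambda>_. 0) \<and> root_space t \<gamma> \<noteq> {0}}"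

definition simple_roots :: "'v set \<Rightarrow> nat \<Rightarrow> (nat \<Rightarrow> 'v \<Rightarrow> 'k) \<Rightarrow> bool" where
  "simple_roots t l \<alpha> \<longleftrightarrow>
     (\<forall>i\<in>{1..l}. \<alpha> i \<in> roots t) \<and>
     (\<forall>c. (\<forall>x. (\<Sum>i=1..l. c i * \<alpha> i x) = 0) \<longrightarrow> (\<forall>i\<in>{1..l}. c i = 0)) \<and>
     (\<forall>\<gamma>\<in>roots t. \<exists>z :: nat \<Rightarrow> int.
        \<gamma> = (\<lambda>x. \<Sum>i=1..l. of_int (z i) * \<alpha> i x) \<and>
        ((\<forall>i\<in>{1..l}. 0 \<le> z i) \<or> (\<forall>i\<in>{1..l}. z i \<le> 0)))"

definition root_coeff :: "nat \<Rightarrow> (nat \<Rightarrow> 'v \<Rightarrow> 'k) \<Rightarrow> ('v \<Rightarrow> 'k) \<Rightarrow> nat \<Rightarrow> int" where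
  "root_coeff l \<alpha> \<gamma> =
     (THE z. \<gamma> = (\<lambda>x. \<Sum>i=1..l. of_int (z i) * \<alpha> i x) \<and> (\<forall>i. i \<notin> {1..l} \<longrightarrow> z i = 0))"

definition highest_root :: "'v set \<Rightarrow> nat \<Rightarrow> (nat \<Rightarrow> 'v \<Rightarrow> 'k) \<Rightarrow> ('v \<Rightarrow> 'k) \<Rightarrow> bool" where
  "highest_root t l \<alpha> \<delta> \<longleftrightarrow> \<delta> \<in> roots t \<and>
     (\<forall>\<gamma>\<in>roots t. \<forall>i\<in>{1..l}. root_coeff l \<alpha> \<gamma> i \<le> root_coeff l \<alpha> \<delta> i)"

definition kac_mark :: "nat \<Rightarrow> (nat \<Rightarrow> 'v \<Rightarrow> 'k) \<Rightarrow> ('v \<Rightarrow> 'k) \<Rightarrow> nat \<Rightarrow> nat" where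
  "kac_mark l \<alpha> \<delta> i = (if i = 0 then 1 else nat (root_coeff l \<alpha> \<delta> i))"

definition kac_order :: "nat \<Rightarrow> (nat \<Rightarrow> 'v \<Rightarrow> 'k) \<Rightarrow> ('v \<Rightarrow> 'k) \<Rightarrow> (nat \<Rightarrow> nat) \<Rightarrow> nat" where
  "kac_order l \<alpha> \<delta> p = (\<Sum>i=0..l. kac_mark l \<alpha> \<delta> i * p i)"

definition kac_degree :: "nat \<Rightarrow> (nat \<Rightarrow> 'v \<Rightarrow> 'k) \<Rightarrow> (nat \<Rightarrow> nat) \<Rightarrow> ('v \<Rightarrow> 'k) \<Rightarrow> int" where
  "kac_degree l \<alpha> p \<gamma> = (\<Sum>i=1..l. root_coeff l \<alpha> \<gamma> i * int (p i))"

text \<open>Since \<open>t\<close> and the root spaces span the algebra, these conditions determine \<open>\<theta>\<close>.\<close>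

definition is_kac_automorphism ::
  "'v set \<Rightarrow> nat \<Rightarrow> (nat \<Rightarrow> 'v \<Rightarrow> 'k) \<Rightarrow> 'k \<Rightarrow> (nat \<Rightarrow> nat) \<Rightarrow> ('v \<Rightarrow> 'v) \<Rightarrow> bool" where
  "is_kac_automorphism t l \<alpha> \<zeta> p \<theta> \<longleftrightarrow>
     lie_automorphism \<theta> \<and> \<theta> \<in> inner_group \<and>
     (\<forall>h\<in>t. \<theta> h = h) \<and>
     (\<forall>\<gamma>\<in>roots t. \<forall>x\<in>root_space t \<gamma>. \<theta> x = scale (\<zeta> powi kac_degree l \<alpha> p \<gamma>) x)"

definition grade :: "'k \<Rightarrow> ('v \<Rightarrow> 'v) \<Rightarrow> nat \<Rightarrow> 'v set" where
  "grade \<zeta> \<theta> i = {x. \<theta> x = scale (\<zeta> ^ i) x}"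

text \<open>The bracket of the \<open>\<theta>\<close>-contraction: the unique bilinear map with the prescribed values on
  homogeneous elements. Here \<open>\<zeta>\<close> is meant to be a primitive root of unity whose order is that
  of \<open>\<theta>\<close>.\<close>

definition contraction :: "'k \<Rightarrow> ('v \<Rightarrow> 'v) \<Rightarrow> 'v \<Rightarrow> 'v \<Rightarrow> 'v" where
  "contraction \<zeta> \<theta> = (THE B.
     (\<forall>y. Vector_Spaces.linear scale scale (\<lambda>x. B x y)) \<and>
     (\<forall>x. Vector_Spaces.linear scale scale (\<lambda>y. B x y)) \<and>
     (\<forall>i<map_order \<theta>. \<forall>j<map_order \<theta>. \<forall>x\<in>grade \<zeta> \<theta> i. \<forall>y\<in>grade \<zeta> \<theta> j.
        B x y = (if i + j \<le> map_order \<theta> - 1 then br x y else 0)))"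

end

locale simple_lie_algebra = lie_algebra +
  assumes finite_dimensional: "\<exists>B. finite B \<and> span B = UNIV"
    and nonabelian: "\<exists>x y. br x y \<noteq> 0"
    and only_trivial_ideals: "lie_ideal I \<Longrightarrow> I = {0} \<or> I = UNIV"

definition kac_labels :: "nat \<Rightarrow> (nat \<Rightarrow> nat) \<Rightarrow> bool" where
  "kac_labels l p \<longleftrightarrow> (\<exists>i\<in>{0..l}. p i \<noteq> 0) \<and> Gcd (p ` {0..l}) = 1"

end

theory Submission
  imports Defs
begin

text \<open>
  On the root space of \<open>\<gamma>\<close> the automorphism acts by \<open>\<zeta>\<close> to the power \<open>d(\<gamma>)\<close>, so the contraction keeps
  \<open>[x, y]\<close>, for \<open>x\<close> of weight \<open>\<gamma>\<close> and \<open>y\<close> of weight \<open>\<mu>\<close>, iff no carry occurs when the residues of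
  \<open>d(\<gamma>)\<close> and \<open>d(\<mu>)\<close> modulo \<open>m\<close> are added, that is, iff \<open>q(\<gamma>) + q(\<mu>) = q(\<gamma> + \<mu>)\<close> for
  \<open>q(\<gamma>) = \<lfloor>d(\<gamma>) / m\<rfloor>\<close>. Since \<open>m = p\<^sub>0 + d(\<delta>)\<close>, every degree lies between \<open>-m\<close> and \<open>m\<close>; hence
  \<open>q(\<gamma>)\<close> is \<open>1\<close> if \<open>d(\<gamma>) = m\<close>, \<open>-1\<close> if \<open>d(\<gamma>) < 0\<close> and \<open>0\<close> otherwise, and which case occurs can be
  read off from the zero pattern of \<open>p\<close>. The lower bound on degrees needs \<open>-\<gamma>\<close> to be a root
  whenever \<open>\<gamma>\<close> is one, which follows from nondegeneracy of the Killing form.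
\<close>

section \<open>Eigenvectors and functionals\<close>

context vector_space
begin

interpretation endo: vector_space_pair scale scale
  by unfold_locales

text \<open>Applying \<open>f\<close> to the relation and subtracting \<open>a\<close> times it
  removes the term of the new eigenvalue \<open>a\<close> and multiplies every other term by the
  nonzero \<open>c - a\<close>. The induction hypothesis is applied to these multiples, which is why
  \<open>v\<close> varies in the induction.\<close>

lemma eigenvectors_sum_zero:
  assumes lin: "Vector_Spaces.linear scale scale f"
    and "finite C" "\<And>c. c \<in> C \<Longrightarrow> f (v c) = scale c (v c)" "sum v C = 0" "c \<in> C"
  shows "v c = 0"
  using assms(2-5)
proof (induction C arbitrary: v c rule: finite_induct)
  case empty
  then show ?case by simp
next
  case (insert a C)
  have "f (sum v (insert a C)) = (\<Sum>c\<in>insert a C. f (v c))"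
    by (rule endo.linear_sum[OF lin])
  then have "(\<Sum>c\<in>insert a C. scale c (v c)) - scale a (sum v (insert a C)) = 0"
    using insert.prems(1,2) endo.linear_0[OF lin] by simp
  then have z: "(\<Sum>c\<in>C. scale (c - a) (v c)) = 0"
    using insert.hyps
    by (simp add: scale_right_distrib scale_sum_right scale_left_diff_distrib sum_subtractf)
  have zero: "v d = 0" if "d \<in> C" for d
  proof -
    have "f (scale (c - a) (v c)) = scale c (scale (c - a) (v c))" if "c \<in> C" for c
      using insert.prems(1) that by (simp add: endo.linear_scale[OF lin] mult.commute)
    then have "scale (d - a) (v d) = 0"
      by (rule insert.IH[OF _ z \<open>d \<in> C\<close>])
    then show ?thesis
      using that insert.hyps by auto
  qed
  then show ?case
    using insert.prems(2,3) insert.hyps by auto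
qed

lemma span_eigenvectors_eigenvector:
  assumes lin: "Vector_Spaces.linear scale scale f"
    and "x \<in> span {s \<in> S. f s = scale c s}"
  shows "f x = scale c x"
  using assms(2)
proof (induction rule: span_induct_alt)
  case base
  then show ?case by (simp add: endo.linear_0[OF lin])
next
  case (step d s y)
  then show ?case
    by (simp add: endo.linear_add[OF lin] endo.linear_scale[OF lin] scale_right_distrib mult.commute)
qed

text \<open>The terms of a linear combination are collected by eigenvalue. Asking for
  \<open>v c\<close> in the span for every \<open>c\<close>, and for zero outside \<open>C\<close>,
  lets the induction add a vector to the component at \<open>d\<close> whether or not
  \<open>d\<close> is already in \<open>C\<close>.\<close>

lemma eigenvector_decomposition:
  assumes "\<And>s. s \<in> S \<Longrightarrow> \<exists>c. f s = scale c s" and "x \<in> span S"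
  obtains C v where "finite C" "x = sum v C" "\<And>c. v c \<in> span {s \<in> S. f s = scale c s}"
    "\<And>c. c \<notin> C \<Longrightarrow> v c = 0"
proof -
  have "\<exists>C v. finite C \<and> x = sum v C \<and> (\<forall>c. v c \<in> span {s \<in> S. f s = scale c s}) \<and>
      (\<forall>c. c \<notin> C \<longrightarrow> v c = 0)"
    using assms(2)
  proof (induction rule: span_induct_alt)
    case base
    show ?case by (intro exI[of _ "{}"] exI[of _ "\<lambda>_. 0"]) (auto simp: span_zero)
  next
    case (step a s y)
    then obtain C v where C: "finite C" "y = sum v C"
      and v: "\<forall>c. v c \<in> span {s \<in> S. f s = scale c s}" "\<forall>c. c \<notin> C \<longrightarrow> v c = 0"
      by blast
    obtain d where d: "f s = scale d s"
      using assms(1) step.hyps by blast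
    let ?v = "v(d := scale a s + v d)"
    have "sum ?v (insert d C) = scale a s + v d + sum v (C - {d})"
      using C(1) by (simp add: sum.insert_remove)
    also have "\<dots> = scale a s + sum v C"
      using C(1) v(2) by (cases "d \<in> C") (auto simp: sum.remove add.assoc)
    finally have "scale a s + y = sum ?v (insert d C)"
      using C(2) by simp
    moreover have "?v c \<in> span {s \<in> S. f s = scale c s}" for c
    proof (cases "c = d")
      case True
      have "s \<in> {s \<in> S. f s = scale d s}"
        using d step.hyps by simp
      then have "scale a s + v d \<in> span {s \<in> S. f s = scale d s}"
        using v(1) by (intro span_add[OF span_scale[OF span_base]]) blast+
      then show ?thesis using True by simp
    qed (use v(1) in simp)
    ultimately show ?case
      using C(1) v(2) by (intro exI[of _ "insert d C"] exI[of _ ?v]) auto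
  qed
  then show ?thesis using that by blast
qed

text \<open>Eigencomponents are unique, so an eigenvector with eigenvalue \<open>a\<close> equals
  its own component at \<open>a\<close>. This will identify the grades of the automorphism with sums
  of weight spaces.\<close>

lemma eigenspace_subset_span:
  assumes lin: "Vector_Spaces.linear scale scale f"
    and eig: "\<And>s. s \<in> S \<Longrightarrow> \<exists>c. f s = scale c s" and "x \<in> span S" and fx: "f x = scale a x"
  shows "x \<in> span {s \<in> S. f s = scale a s}"
proof -
  obtain C v where C: "finite C" "x = sum v C"
    and v: "\<And>c. v c \<in> span {s \<in> S. f s = scale c s}" and v0: "\<And>c. c \<notin> C \<Longrightarrow> v c = 0"
    using eigenvector_decomposition[OF eig \<open>x \<in> span S\<close>] by metis
  have fv: "f (v c) = scale c (v c)" for c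
    by (rule span_eigenvectors_eigenvector[OF lin v])
  \<comment> \<open>Subtracting \<open>x\<close> from the component at \<open>a\<close> gives
    eigenvectors for distinct eigenvalues with sum zero, so each of them vanishes.\<close>
  define w where "w = v(a := v a - x)"
  have "v c = 0" if "c \<noteq> a" for c
  proof (cases "c \<in> C")
    case True
    have "f (w b) = scale b (w b)" for b
      using fv fx by (simp add: w_def endo.linear_diff[OF lin] scale_right_diff_distrib)
    moreover have "sum w (insert a C) = 0"
    proof -
      have "sum w (insert a C) = v a - x + sum v (C - {a})"
        using C(1) by (simp add: w_def sum.insert_remove)
      also have "v a + sum v (C - {a}) = x"
        using C v0[of a] by (cases "a \<in> C") (auto simp: sum.remove)
      then have "v a - x + sum v (C - {a}) = 0"
        by (simp add: algebra_simps)
      finally show ?thesis .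
    qed
    ultimately have "w c = 0"
      using eigenvectors_sum_zero[OF lin, of "insert a C" w c] C(1) True by simp
    then show ?thesis using that by (simp add: w_def)
  qed (use v0 in simp)
  then have "sum v C = v a"
    using C(1) v0 by (metis (no_types, lifting) sum.neutral sum.remove add.right_neutral DiffD2 singletonI)
  then show ?thesis using v C(2) by metis
qed

text \<open>Simultaneous diagonalization, one map at a time: a joint eigenvector of the earlier maps
  splits into eigencomponents of \<open>f a\<close>, and commutation keeps each component an
  eigenvector of the earlier maps.\<close>

lemma joint_eigenvectors_span:
  assumes "finite F" "\<And>a. a \<in> F \<Longrightarrow> Vector_Spaces.linear scale scale (f a)"
    and "\<And>a. a \<in> F \<Longrightarrow> span {x. \<exists>c. f a x = scale c x} = UNIV"
    and "\<And>a b x. a \<in> F \<Longrightarrow> b \<in> F \<Longrightarrow> f a (f b x) = f b (f a x)"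
  shows "span {x. \<forall>a\<in>F. \<exists>c. f a x = scale c x} = UNIV"
  using assms
proof (induction F rule: finite_induct)
  case empty
  then show ?case by simp
next
  case (insert a F)
  let ?T = "{x. \<forall>b\<in>insert a F. \<exists>c. f b x = scale c x}"
  have lin: "Vector_Spaces.linear scale scale (f b)" if "b \<in> insert a F" for b
    using insert.prems(1) that .
  have "x \<in> span ?T" if x: "\<forall>b\<in>F. \<exists>c. f b x = scale c x" for x
  proof -
    have "x \<in> span {x. \<exists>c. f a x = scale c x}"
      using insert.prems(2)[of a] by simp
    then obtain C v where C: "finite C" "x = sum v C"
      and v: "\<And>c. v c \<in> span {s \<in> {x. \<exists>c. f a x = scale c x}. f a s = scale c s}"
      by (rule eigenvector_decomposition[where f = "f a", rotated]) blast+
    have fv: "f a (v c) = scale c (v c)" for c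
      by (rule span_eigenvectors_eigenvector[OF lin v]) simp
    have "v c \<in> ?T" if "c \<in> C" for c
    proof -
      have "\<exists>e. f b (v c) = scale e (v c)" if b: "b \<in> F" for b
      proof -
        have bin: "b \<in> insert a F" using b by simp
        obtain e where e: "f b x = scale e x" using x b by blast
        \<comment> \<open>\<open>u c\<close> measures how far \<open>v c\<close> is from being an
          eigenvector of \<open>f b\<close> with the eigenvalue \<open>e\<close> of
          \<open>x\<close>. It satisfies the eigenvector equation of \<open>f a\<close> for
          \<open>c\<close>, and these vectors add up to
          \<open>f b x - scale e x = 0\<close>.\<close>
        define u where "u = (\<lambda>c. f b (v c) - scale e (v c))"
        have "f a (u d) = scale d (u d)" for d
          using insert.prems(3)[of a b "v d"] bin fv[of d]
          by (simp add: u_def endo.linear_diff[OF lin] endo.linear_scale[OF lin]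
              scale_right_diff_distrib mult.commute)
        moreover have "sum u C = 0"
          using e unfolding C(2)
          by (simp add: u_def sum_subtractf endo.linear_sum[OF lin[OF bin]] scale_sum_right)
        ultimately have "u c = 0"
          using eigenvectors_sum_zero[OF lin[of a] C(1), of u c] \<open>c \<in> C\<close> by simp
        then show ?thesis by (auto simp: u_def)
      qed
      then show ?thesis using fv[of c] by auto
    qed
    then show ?thesis
      unfolding C(2) by (intro span_sum span_base)
  qed
  then have "span {x. \<forall>b\<in>F. \<exists>c. f b x = scale c x} \<subseteq> span ?T"
    by (intro span_minimal) auto
  then show ?case
    using insert.IH insert.prems by auto
qed

text \<open>On the kernel of \<open>a j\<close> the induction hypothesis writes
  \<open>\<beta>\<close> through the other functionals; the defect \<open>r\<close> vanishes on that
  kernel, so it is a multiple of \<open>a j\<close>. The domain \<open>T\<close> varies because it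
  shrinks to the kernel, and linearity is asked only on \<open>T\<close> to suit functionals
  extended by zero.\<close>

lemma functional_in_span_if_kernels:
  fixes \<beta> :: "'b \<Rightarrow> 'a"
  assumes "finite I" "subspace T"
    and "\<And>i x y. i \<in> I \<Longrightarrow> x \<in> T \<Longrightarrow> y \<in> T \<Longrightarrow> a i (x + y) = a i x + a i y"
    and "\<And>i c x. i \<in> I \<Longrightarrow> x \<in> T \<Longrightarrow> a i (scale c x) = c * a i x"
    and "\<And>x y. x \<in> T \<Longrightarrow> y \<in> T \<Longrightarrow> \<beta> (x + y) = \<beta> x + \<beta> y"
    and "\<And>c x. x \<in> T \<Longrightarrow> \<beta> (scale c x) = c * \<beta> x"
    and "\<And>x. x \<in> T \<Longrightarrow> \<forall>i\<in>I. a i x = 0 \<Longrightarrow> \<beta> x = 0"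
  shows "\<exists>c. \<forall>x\<in>T. \<beta> x = (\<Sum>i\<in>I. c i * a i x)"
  using assms
proof (induction I arbitrary: T rule: finite_induct)
  case empty
  then show ?case by simp
next
  case (insert j I)
  note T = \<open>subspace T\<close>
  let ?T = "{x \<in> T. a j x = 0}"
  have add: "a i (x + y) = a i x + a i y" if "i \<in> insert j I" "x \<in> T" "y \<in> T" for i x y
    using insert.prems(2) that .
  have scl: "a i (scale c x) = c * a i x" if "i \<in> insert j I" "x \<in> T" for i c x
    using insert.prems(3) that .
  have "a j 0 = 0"
    using scl[of j 0 0] subspace_0[OF T] by simp
  then have "subspace ?T"
    using T add[of j] scl[of j] by (auto simp: subspace_def)
  then have "\<exists>c. \<forall>x\<in>?T. \<beta> x = (\<Sum>i\<in>I. c i * a i x)"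
    using insert.prems by (intro insert.IH) auto
  then obtain c where c: "\<And>x. x \<in> T \<Longrightarrow> a j x = 0 \<Longrightarrow> \<beta> x = (\<Sum>i\<in>I. c i * a i x)"
    by blast
  show ?case
  proof (cases "\<forall>x\<in>T. a j x = 0")
    case True
    then show ?thesis
      using c insert.hyps by (intro exI[of _ c]) simp
  next
    case False
    then obtain u where u: "u \<in> T" "a j u \<noteq> 0" by blast
    define r where "r = (\<lambda>x. \<beta> x - (\<Sum>i\<in>I. c i * a i x))"
    have "\<beta> x = (\<Sum>i\<in>insert j I. (c(j := r u / a j u)) i * a i x)" if x: "x \<in> T" for x
    proof -
      define q where "q = a j x / a j u"
      \<comment> \<open>The projection of \<open>x\<close> along \<open>u\<close> to the kernel of
        \<open>a j\<close>.\<close>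
      define y where "y = x + scale (- q) u"
      have yT: "y \<in> T"
        unfolding y_def using T x u by (intro subspace_add subspace_scale)
      have su: "scale (- q) u \<in> T"
        using T u by (intro subspace_scale)
      have a_y: "a i y = a i x - q * a i u" if "i \<in> insert j I" for i
        using add[of i x "scale (- q) u"] scl[of i u "- q"] x u su that by (simp add: y_def)
      then have "a j y = 0"
        using u by (simp add: q_def)
      then have "r y = 0"
        using c yT by (simp add: r_def)
      moreover have "r y = r x - q * r u"
      proof -
        have "(\<Sum>i\<in>I. c i * a i y) = (\<Sum>i\<in>I. c i * a i x) - q * (\<Sum>i\<in>I. c i * a i u)"
          by (simp add: a_y sum_distrib_left sum_subtractf[symmetric] algebra_simps)
        moreover have "\<beta> y = \<beta> x - q * \<beta> u"
          using insert.prems(4)[OF x su] insert.prems(5)[OF u(1), of "- q"] by (simp add: y_def)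
        ultimately show ?thesis by (simp add: r_def algebra_simps)
      qed
      ultimately have "\<beta> x = (\<Sum>i\<in>I. c i * a i x) + q * r u"
        by (simp add: r_def algebra_simps)
      moreover have "(\<Sum>i\<in>I. (c(j := r u / a j u)) i * a i x) = (\<Sum>i\<in>I. c i * a i x)"
        using insert.hyps by (intro sum.cong) auto
      ultimately show ?thesis
        using insert.hyps by (simp add: q_def mult.commute)
    qed
    then show ?thesis by blast
  qed
qed

end

section \<open>The Killing form and the root system\<close>

context lie_algebra
begin

interpretation endo: vector_space_pair scale scale
  by unfold_locales

section \<open>Traces with respect to a basis\<close>

definition basis_trace :: "'v set \<Rightarrow> ('v \<Rightarrow> 'v) \<Rightarrow> 'k" where
  "basis_trace B f = (\<Sum>b\<in>B. representation B (f b) b)"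

lemma basis_trace_add:
  "independent B \<Longrightarrow> span B = UNIV \<Longrightarrow> basis_trace B (\<lambda>x. f x + g x) = basis_trace B f + basis_trace B g"
  by (simp add: basis_trace_def representation_add sum.distrib)

lemma basis_trace_diff:
  "independent B \<Longrightarrow> span B = UNIV \<Longrightarrow> basis_trace B (\<lambda>x. f x - g x) = basis_trace B f - basis_trace B g"
  by (simp add: basis_trace_def representation_diff sum_subtractf)

lemma basis_trace_scale:
  "independent B \<Longrightarrow> span B = UNIV \<Longrightarrow> basis_trace B (\<lambda>x. scale c (f x)) = c * basis_trace B f"
  by (simp add: basis_trace_def representation_scale sum_distrib_left)

lemma basis_trace_zero: "basis_trace B (\<lambda>x. 0) = 0"
  by (simp add: basis_trace_def representation_zero)

text \<open>In matrix entries, both traces are the same double sum with the order of summation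
  exchanged.\<close>

lemma basis_trace_commute:
  assumes B: "independent B" "span B = UNIV" "finite B"
    and f: "Vector_Spaces.linear scale scale f" and g: "Vector_Spaces.linear scale scale g"
  shows "basis_trace B (\<lambda>x. f (g x)) = basis_trace B (\<lambda>x. g (f x))"
proof -
  have expand: "basis_trace B (\<lambda>x. f (g x)) =
      (\<Sum>b\<in>B. \<Sum>c\<in>B. representation B (g b) c * representation B (f c) b)"
    if f: "Vector_Spaces.linear scale scale f" for f g
  proof -
    have "f (g b) = (\<Sum>c\<in>B. scale (representation B (g b) c) (f c))" for b
    proof -
      have "f (g b) = f (\<Sum>c\<in>B. scale (representation B (g b) c) c)"
        using B by (simp add: sum_representation_eq)
      then show ?thesis
        by (simp add: endo.linear_sum[OF f] endo.linear_scale[OF f])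
    qed
    then have "representation B (f (g b)) b =
        (\<Sum>c\<in>B. representation B (g b) c * representation B (f c) b)" for b
      using B by (simp add: representation_sum representation_scale)
    then show ?thesis by (simp add: basis_trace_def)
  qed
  have "basis_trace B (\<lambda>x. f (g x)) =
      (\<Sum>c\<in>B. \<Sum>b\<in>B. representation B (g b) c * representation B (f c) b)"
    unfolding expand[OF f] by (rule sum.swap)
  also have "\<dots> = basis_trace B (\<lambda>x. g (f x))"
    unfolding expand[OF g] by (simp add: mult.commute)
  finally show ?thesis .
qed

lemma basis_trace_diagonal:
  assumes "independent B" "span B = UNIV" "\<And>b. b \<in> B \<Longrightarrow> f b = scale (e b) b"
  shows "basis_trace B f = (\<Sum>b\<in>B. e b)"
  using assms by (simp add: basis_trace_def representation_scale representation_basis)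

section \<open>Bracket identities and weight spaces\<close>

lemmas br_add_left = endo.linear_add[OF br_linear_left]
  and br_add_right = endo.linear_add[OF br_linear_right]
  and br_diff_right = endo.linear_diff[OF br_linear_right]
  and br_scale_left = endo.linear_scale[OF br_linear_left]
  and br_scale_right = endo.linear_scale[OF br_linear_right]
  and br_zero_left = endo.linear_0[OF br_linear_left]
  and br_zero_right = endo.linear_0[OF br_linear_right]

lemma br_skew: "br x y = - br y x"
proof -
  have "br x y + br y x = br (x + y) (x + y)"
    using br_alternating[of x] br_alternating[of y] by (simp add: br_add_left br_add_right)
  also have "\<dots> = 0"
    by (rule br_alternating)
  finally have "br x y + br y x = 0" .
  then show ?thesis
    by (simp add: eq_neg_iff_add_eq_0)
qed

lemma br_derivation: "br h (br x y) = br (br h x) y + br x (br h y)"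
proof -
  have "br x (br y h) = - br x (br h y)"
    using br_skew[of y h] endo.linear_neg[OF br_linear_right] by simp
  then show ?thesis
    using jacobi[of h x y] br_skew[of y "br h x"]
    by (simp add: algebra_simps add_eq_0_iff)
qed

lemma ad_br: "br (br x y) z = br x (br y z) - br y (br x z)"
  using br_derivation[of x y z] by simp

lemma subspace_root_space: "subspace (root_space t \<gamma>)"
  unfolding root_space_def subspace_def
  by (auto simp: br_add_right br_scale_right br_zero_right scale_right_distrib mult.commute)

lemma br_in_root_space:
  assumes "x \<in> root_space t \<gamma>" "y \<in> root_space t \<mu>"
  shows "br x y \<in> root_space t (\<lambda>h. \<gamma> h + \<mu> h)"
  using assms by (auto simp: root_space_def br_derivation br_scale_left br_scale_right
      scale_left_distrib)

text \<open>The zero functional is included because its root space is the Cartan subalgebra itself;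
  only with it do the weight spaces span the algebra.\<close>

definition weights :: "'v set \<Rightarrow> ('v \<Rightarrow> 'k) set" where
  "weights t = insert (\<lambda>_. 0) (roots t)"

lemma root_space_eq_zero_if_not_weight:
  "\<gamma> \<in> dual t \<Longrightarrow> \<gamma> \<notin> weights t \<Longrightarrow> root_space t \<gamma> = {0}"
  by (auto simp: weights_def roots_def)

lemma dual_add: "\<gamma> \<in> dual t \<Longrightarrow> \<mu> \<in> dual t \<Longrightarrow> (\<lambda>h. \<gamma> h + \<mu> h) \<in> dual t"
  by (simp add: dual_def algebra_simps)

lemma weights_subset_dual: "weights t \<subseteq> dual t"
  by (auto simp: weights_def roots_def dual_def)

lemma root_space_zero:
  "cartan_subalgebra t \<Longrightarrow> root_space t (\<lambda>_. 0) = t"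
  by (auto simp: cartan_subalgebra_def root_space_def)

section \<open>The Killing form and its radical\<close>

definition killing :: "'v set \<Rightarrow> 'v \<Rightarrow> 'v \<Rightarrow> 'k" where
  "killing B x y = basis_trace B (\<lambda>z. br x (br y z))"

context
  fixes B assumes B: "independent B" "span B = UNIV" "finite B"
begin

lemma killing_commute: "killing B x y = killing B y x"
  unfolding killing_def by (rule basis_trace_commute[OF B br_linear_right br_linear_right])

lemma killing_add_left: "killing B (x + y) z = killing B x z + killing B y z"
  unfolding killing_def by (simp add: br_add_left basis_trace_add B)

lemma killing_scale_left: "killing B (scale c x) y = c * killing B x y"
  unfolding killing_def by (simp add: br_scale_left basis_trace_scale B)

lemma killing_zero_left: "killing B 0 y = 0"
  by (simp add: killing_def br_zero_left basis_trace_zero)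

text \<open>By \<open>ad_br\<close> both sides become differences of traces of triple products with
  one term in common. The remaining two terms agree because \<open>br y\<close> commutes under the
  trace with the composite of \<open>br x\<close> and \<open>br z\<close>.\<close>

lemma killing_invariant: "killing B (br x y) z = killing B x (br y z)"
proof -
  have lin: "Vector_Spaces.linear scale scale (\<lambda>v. br x (br z v))"
    using Vector_Spaces.linear_compose[OF br_linear_right br_linear_right] by (simp add: comp_def)
  have "basis_trace B (\<lambda>v. br y (br x (br z v))) = basis_trace B (\<lambda>v. br x (br z (br y v)))"
    by (rule basis_trace_commute[OF B br_linear_right lin])
  then show ?thesis
    by (simp add: killing_def ad_br br_diff_right basis_trace_diff B)
qed

text \<open>Invariance moves the bracket from the radical element to the other argument. In a simple
  algebra this leaves only the zero space and the whole algebra as possible radicals.\<close>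

lemma lie_ideal_killing_radical: "lie_ideal {x. \<forall>y. killing B x y = 0}"
proof -
  have "killing B (br x y) z = 0" if "\<forall>z. killing B y z = 0" for x y z
    using that killing_invariant[of y x "z"] br_skew[of x y] killing_scale_left[of "-1" "br y x" z]
    by simp
  then show ?thesis
    by (auto simp: lie_ideal_def subspace_def killing_add_left killing_scale_left
        killing_zero_left)
qed

text \<open>Moving \<open>h\<close> from \<open>x\<close> to \<open>y\<close> by invariance shows
  that \<open>\<gamma> h\<close> and \<open>- \<mu> h\<close> have the same product with the value
  of the form.\<close>

lemma killing_root_spaces_orthogonal:
  assumes "x \<in> root_space t \<gamma>" "y \<in> root_space t \<mu>" "h \<in> t" "\<gamma> h + \<mu> h \<noteq> 0"
  shows "killing B x y = 0"
proof -
  have "\<gamma> h * killing B x y = killing B (br h x) y"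
    using assms by (simp add: root_space_def killing_scale_left)
  also have "\<dots> = - killing B (br x h) y"
    using br_skew[of h x] killing_scale_left[of "-1" "br x h" y] by simp
  also have "\<dots> = - killing B x (br h y)"
    by (simp add: killing_invariant)
  also have "\<dots> = - (\<mu> h * killing B x y)"
    using assms by (simp add: root_space_def killing_commute[of x] killing_scale_left)
  finally have "(\<gamma> h + \<mu> h) * killing B x y = 0"
    by (simp add: algebra_simps)
  then show ?thesis using assms by simp
qed

end

end

section \<open>The weight space decomposition\<close>

lemma (in simple_lie_algebra) finite_if_independent: "independent B \<Longrightarrow> finite B"
  using finite_dimensional independent_span_bound by blast

text \<open>The maps \<open>br h\<close> for \<open>h\<close> in a basis of \<open>t\<close> commute
  and are diagonalizable, so their joint eigenvectors span. A nonzero joint eigenvector is a weight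
  vector, its weight being the eigenvalue as a function of \<open>h\<close>.\<close>

lemma (in simple_lie_algebra) weight_spaces_span:
  assumes t: "cartan_subalgebra t"
  shows "span (\<Union>\<gamma>\<in>weights t. root_space t \<gamma>) = UNIV"
proof -
  have sub: "subspace t" and comm: "\<And>h h'. h \<in> t \<Longrightarrow> h' \<in> t \<Longrightarrow> br h h' = 0"
    and diag: "\<And>h. h \<in> t \<Longrightarrow> diagonalizable (br h)"
    using t by (auto simp: cartan_subalgebra_def)
  obtain F where F: "F \<subseteq> t" "independent F" "t \<subseteq> span F"
    by (rule maximal_independent_subset)
  have span_F: "span {x. \<forall>h\<in>F. \<exists>c. br h x = scale c x} = UNIV"
  proof (rule joint_eigenvectors_span)
    show "finite F" using F(2) by (rule finite_if_independent)
    show "span {x. \<exists>c. br h x = scale c x} = UNIV" if "h \<in> F" for h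
      using diag that F(1) by (auto simp: diagonalizable_def)
    show "br h (br h' x) = br h' (br h x)" if "h \<in> F" "h' \<in> F" for h h' x
    proof -
      have "br h h' = 0" using comm that F(1) by blast
      then show ?thesis using ad_br[of h h' x] by (simp add: br_zero_left)
    qed
  qed (rule br_linear_right)
  have "x \<in> (\<Union>\<gamma>\<in>weights t. root_space t \<gamma>)"
    if x: "\<forall>h\<in>F. \<exists>c. br h x = scale c x" for x
  proof (cases "x = 0")
    case True
    then show ?thesis
      using subspace_0[OF subspace_root_space] by (auto simp: weights_def)
  next
    case False
    \<comment> \<open>Being an eigenvector passes from the basis \<open>F\<close> to all of
      \<open>t\<close>, since the elements having \<open>x\<close> as eigenvector form a
      subspace.\<close>
    have "subspace {h. \<exists>c. br h x = scale c x}"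
      unfolding subspace_def
    proof (intro conjI ballI allI)
      have "br 0 x = scale 0 x"
        by (simp add: br_zero_left)
      then show "0 \<in> {h. \<exists>c. br h x = scale c x}"
        by blast
      fix h assume h: "h \<in> {h. \<exists>c. br h x = scale c x}"
      then obtain c where c: "br h x = scale c x"
        by blast
      show "h + h' \<in> {h. \<exists>c. br h x = scale c x}"
        if h': "h' \<in> {h. \<exists>c. br h x = scale c x}" for h'
      proof -
        obtain d where "br h' x = scale d x"
          using h' by blast
        then have "br (h + h') x = scale (c + d) x"
          by (simp add: c br_add_left scale_left_distrib)
        then show ?thesis by blast
      qed
      show "scale d h \<in> {h. \<exists>c. br h x = scale c x}" for d
      proof -
        have "br (scale d h) x = scale (d * c) x"
          by (simp add: c br_scale_left)
        then show ?thesis by blast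
      qed
    qed
    then have "span F \<subseteq> {h. \<exists>c. br h x = scale c x}"
      using x by (intro span_minimal) auto
    then have ex: "\<exists>c. br h x = scale c x" if "h \<in> t" for h
      using that F(3) by auto
    \<comment> \<open>The value zero outside \<open>t\<close> is the convention of
      \<open>dual\<close>. On \<open>t\<close> the eigenvalue is unique because \<open>x\<close> is
      nonzero, and this uniqueness makes \<open>\<gamma>\<close> linear.\<close>
    define \<gamma> where "\<gamma> = (\<lambda>h. if h \<in> t then SOME c. br h x = scale c x else 0)"
    have \<gamma>: "br h x = scale (\<gamma> h) x" if "h \<in> t" for h
      using someI_ex[OF ex[OF that]] that by (simp add: \<gamma>_def)
    have \<gamma>I: "\<gamma> h = c" if "h \<in> t" "br h x = scale c x" for h c
      using \<gamma>[OF that(1)] that(2) False by simp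
    have "\<gamma> \<in> dual t"
      unfolding dual_def
    proof (intro CollectI conjI ballI allI impI)
      show "\<gamma> (h + h') = \<gamma> h + \<gamma> h'" if "h \<in> t" "h' \<in> t" for h h'
        using that \<gamma> by (intro \<gamma>I subspace_add[OF sub]) (auto simp: br_add_left scale_left_distrib)
      show "\<gamma> (scale c h) = c * \<gamma> h" if "h \<in> t" for c h
        using that \<gamma> by (intro \<gamma>I subspace_scale[OF sub]) (auto simp: br_scale_left)
    qed (simp add: \<gamma>_def)
    moreover have "x \<in> root_space t \<gamma>"
      using \<gamma> by (simp add: root_space_def)
    ultimately show ?thesis
      using False root_space_eq_zero_if_not_weight[of \<gamma> t] by blast
  qed
  then have "{x. \<forall>h\<in>F. \<exists>c. br h x = scale c x} \<subseteq> (\<Union>\<gamma>\<in>weights t. root_space t \<gamma>)"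
    by blast
  from span_mono[OF this] show ?thesis
    using span_F by auto
qed

section \<open>Coweights and the symmetry of the root system\<close>

locale based_root_system = simple_lie_algebra scale br
  for scale :: "'k::field_char_0 \<Rightarrow> 'v::ab_group_add \<Rightarrow> 'v" and br +
  fixes t :: "'v set" and l :: nat and \<alpha> :: "nat \<Rightarrow> 'v \<Rightarrow> 'k"
  assumes cartan: "cartan_subalgebra t"
    and simple: "simple_roots t l \<alpha>"
begin

interpretation endo: vector_space_pair scale scale
  by unfold_locales

lemma simple_root: "i \<in> {1..l} \<Longrightarrow> \<alpha> i \<in> roots t"
  and simple_roots_independent: "(\<And>x. (\<Sum>i=1..l. c i * \<alpha> i x) = 0) \<Longrightarrow> i \<in> {1..l} \<Longrightarrow> c i = 0"
  and root_expansion: "\<gamma> \<in> roots t \<Longrightarrow> \<exists>z :: nat \<Rightarrow> int.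
        \<gamma> = (\<lambda>x. \<Sum>i=1..l. of_int (z i) * \<alpha> i x) \<and>
        ((\<forall>i\<in>{1..l}. 0 \<le> z i) \<or> (\<forall>i\<in>{1..l}. z i \<le> 0))"
  using simple unfolding simple_roots_def by blast+

text \<open>If \<open>\<alpha> i\<close> vanished wherever the other simple roots do, it would be a
  combination of them, against independence. So some \<open>h\<close> is killed by the others but
  not by \<open>\<alpha> i\<close>, and it can be rescaled.\<close>

lemma fundamental_coweight:
  assumes i: "i \<in> {1..l}"
  obtains h where "h \<in> t" "\<And>j. j \<in> {1..l} \<Longrightarrow> \<alpha> j h = (if j = i then 1 else 0)"
proof -
  have sub: "subspace t" using cartan by (simp add: cartan_subalgebra_def)
  have dual: "\<alpha> j \<in> dual t" if "j \<in> {1..l}" for j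
    using simple_root[OF that] by (simp add: roots_def)
  have "\<exists>h\<in>t. (\<forall>j\<in>{1..l} - {i}. \<alpha> j h = 0) \<and> \<alpha> i h \<noteq> 0"
  proof (rule ccontr)
    assume "\<not> ?thesis"
    then have "\<exists>c. \<forall>x\<in>t. \<alpha> i x = (\<Sum>j\<in>{1..l} - {i}. c j * \<alpha> j x)"
      using dual i by (intro functional_in_span_if_kernels[OF _ sub]) (auto simp: dual_def)
    then obtain c where c: "\<And>x. x \<in> t \<Longrightarrow> \<alpha> i x = (\<Sum>j\<in>{1..l} - {i}. c j * \<alpha> j x)"
      by blast
    \<comment> \<open>The coefficient -1 at \<open>i\<close> turns the expression of
      \<open>\<alpha> i\<close> on \<open>t\<close> into a linear relation. It holds outside
      \<open>t\<close> as well, where every term vanishes by convention.\<close>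
    have "(\<Sum>j=1..l. (c(i := - 1)) j * \<alpha> j x) = 0" for x
    proof (cases "x \<in> t")
      case True
      have "(\<Sum>j=1..l. (c(i := - 1)) j * \<alpha> j x) = - \<alpha> i x + (\<Sum>j\<in>{1..l} - {i}. c j * \<alpha> j x)"
        using i by (simp add: sum.remove[of _ i])
      then show ?thesis using c[OF True] by simp
    next
      case False
      then show ?thesis using dual by (intro sum.neutral) (auto simp: dual_def)
    qed
    from simple_roots_independent[of "c(i := - 1)", OF this i] show False by simp
  qed
  then obtain h where h: "h \<in> t" "\<forall>j\<in>{1..l} - {i}. \<alpha> j h = 0" "\<alpha> i h \<noteq> 0"
    by blast
  show ?thesis
  proof (rule that[of "scale (inverse (\<alpha> i h)) h"])
    show "scale (inverse (\<alpha> i h)) h \<in> t" using h(1) sub by (simp add: subspace_scale)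
    show "\<alpha> j (scale (inverse (\<alpha> i h)) h) = (if j = i then 1 else 0)" if "j \<in> {1..l}" for j
      using dual[OF that] h that by (auto simp: dual_def)
  qed
qed

text \<open>A coweight \<open>h\<close> acts with integral eigenvalues, so the Killing form at \<open>(h, h)\<close> is a sum of
  squares of integers. Hence the form does not vanish, and by simplicity it is nondegenerate.\<close>

lemma uminus_root:
  assumes \<gamma>: "\<gamma> \<in> roots t"
  shows "(\<lambda>x. - \<gamma> x) \<in> roots t"
proof (rule ccontr)
  assume neg: "(\<lambda>x. - \<gamma> x) \<notin> roots t"
  let ?W = "\<Union>\<gamma>\<in>weights t. root_space t \<gamma>"
  have dual: "\<gamma> \<in> dual t" and nz: "\<gamma> \<noteq> (\<lambda>_. 0)"
    using \<gamma> by (auto simp: roots_def)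
  \<comment> \<open>In a basis of weight vectors, \<open>br h\<close> is diagonal for each
    \<open>h\<close> in \<open>t\<close>, so the trace defining the Killing form can be
    computed.\<close>
  obtain B where "B \<subseteq> ?W" and indep: "independent B" and "?W \<subseteq> span B"
    by (rule maximal_independent_subset)
  then have span: "span B = UNIV"
    using weight_spaces_span[OF cartan] span_mono[OF \<open>?W \<subseteq> span B\<close>] by (auto simp: span_span)
  note B = indep span finite_if_independent[OF indep]
  obtain w where w: "\<And>b. b \<in> B \<Longrightarrow> w b \<in> weights t \<and> b \<in> root_space t (w b)"
    using \<open>B \<subseteq> ?W\<close> by (metis UN_E subsetD)
  obtain z where "\<gamma> = (\<lambda>x. \<Sum>i=1..l. of_int (z i) * \<alpha> i x)"
    using root_expansion[OF \<gamma>] by blast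
  \<comment> \<open>Over an empty index range the expansion would make \<open>\<gamma>\<close> zero,
    so there is at least one simple root.\<close>
  then obtain i where i: "i \<in> {1..l}"
    using nz by (metis (no_types, lifting) sum.neutral)
  obtain h where h: "h \<in> t" "\<And>j. j \<in> {1..l} \<Longrightarrow> \<alpha> j h = (if j = i then 1 else 0)"
    using fundamental_coweight[OF i] by blast
  have "\<exists>k :: int. w b h = of_int k" if b: "b \<in> B" for b
  proof (cases "w b \<in> roots t")
    case True
    then obtain z where "w b = (\<lambda>x. \<Sum>i=1..l. of_int (z i) * \<alpha> i x)"
      using root_expansion by blast
    then have "w b h = (\<Sum>j=1..l. of_int (z j * (if j = i then 1 else 0)))"
      using h(2) by (auto intro!: sum.cong)
    then have "w b h = of_int (\<Sum>j=1..l. z j * (if j = i then 1 else 0))"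
      by (simp only: of_int_sum)
    then show ?thesis by blast
  next
    case False
    then show ?thesis using w[OF b] by (auto simp: weights_def intro: exI[of _ 0])
  qed
  then obtain k :: "'v \<Rightarrow> int" where k: "\<And>b. b \<in> B \<Longrightarrow> w b h = of_int (k b)"
    by metis
  have act: "br h b = scale (of_int (k b)) b" if "b \<in> B" for b
    using w[OF that] k[OF that] h(1) by (simp add: root_space_def)
  have "killing B h h = (\<Sum>b\<in>B. of_int (k b * k b))"
    unfolding killing_def using B by (intro basis_trace_diagonal) (auto simp: act br_scale_right)
  then have hh: "killing B h h = of_int (\<Sum>b\<in>B. k b * k b)"
    by simp
  have "killing B h h \<noteq> 0"
  proof
    assume "killing B h h = 0"
    then have "(\<Sum>b\<in>B. k b * k b) = 0"
      unfolding hh by (simp only: of_int_eq_0_iff)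
    then have "\<forall>b\<in>B. k b * k b = 0"
      using sum_nonneg_eq_0_iff[OF B(3), of "\<lambda>b. k b * k b"] by simp
    then have "k b = 0" if "b \<in> B" for b
      using that by simp
    \<comment> \<open>With all eigenvalues zero, \<open>h\<close> would act as zero, although it
      acts as the identity on the root space of \<open>\<alpha> i\<close>.\<close>
    then have "br h x = 0" for x
      using endo.linear_eq_0_on_span[OF br_linear_right, of B h x] act span by simp
    moreover obtain x where "x \<in> root_space t (\<alpha> i)" "x \<noteq> 0"
      using simple_root[OF i] subspace_0[OF subspace_root_space] by (auto simp: roots_def)
    ultimately show False
      using h(1) h(2)[OF i] by (auto simp: root_space_def)
  qed
  then have "{x. \<forall>y. killing B x y = 0} \<noteq> UNIV"
    by blast
  then have rad: "{x. \<forall>y. killing B x y = 0} = {0}"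
    using only_trivial_ideals[OF lie_ideal_killing_radical[OF B]] by blast
  obtain x where x: "x \<in> root_space t \<gamma>" "x \<noteq> 0"
    using \<gamma> subspace_0[OF subspace_root_space] by (auto simp: roots_def)
  \<comment> \<open>If the negative of \<open>\<gamma>\<close> is no root, it is no weight either,
    so \<open>x\<close> is orthogonal to every weight space and lies in the radical.\<close>
  have "killing B y x = 0" if "y \<in> ?W" for y
  proof -
    obtain \<mu> where \<mu>: "\<mu> \<in> weights t" "y \<in> root_space t \<mu>"
      using \<open>y \<in> ?W\<close> by blast
    have "\<mu> \<noteq> (\<lambda>x. - \<gamma> x)"
    proof
      assume eq: "\<mu> = (\<lambda>x. - \<gamma> x)"
      then have "\<mu> = (\<lambda>_. 0)"
        using \<mu>(1) neg by (auto simp: weights_def)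
      then have "\<gamma> x = 0" for x
        using fun_cong[OF eq, of x] by simp
      then show False using nz by blast
    qed
    then obtain h' where h': "\<mu> h' + \<gamma> h' \<noteq> 0"
      by (auto simp: fun_eq_iff eq_neg_iff_add_eq_0)
    have "h' \<in> t"
    proof (rule ccontr)
      assume "h' \<notin> t"
      then have "\<mu> h' = 0" "\<gamma> h' = 0"
        using subsetD[OF weights_subset_dual \<mu>(1)] dual by (auto simp: dual_def)
      with h' show False by simp
    qed
    then show ?thesis
      using killing_root_spaces_orthogonal[OF B \<mu>(2) x(1) _ h'] by simp
  qed
  moreover have "subspace {y. killing B y x = 0}"
    by (auto simp: subspace_def killing_add_left killing_scale_left killing_zero_left B)
  ultimately have "span ?W \<subseteq> {y. killing B y x = 0}"
    by (intro span_minimal) auto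
  then have "killing B x y = 0" for y
    using weight_spaces_span[OF cartan] killing_commute[OF B, of x y] by auto
  then show False using rad x(2) by blast
qed


section \<open>Coefficients and degrees of weights\<close>

text \<open>Independence of the simple roots determines the coefficients as field elements, and
  characteristic 0 makes the embedding of the integers injective. Hence the definite description in
  \<open>root_coeff\<close> is well-defined.\<close>

lemma root_coeff_eqI:
  assumes "\<gamma> = (\<lambda>x. \<Sum>i=1..l. of_int (z i) * \<alpha> i x)" and "\<And>i. i \<notin> {1..l} \<Longrightarrow> z i = 0"
  shows "root_coeff l \<alpha> \<gamma> = z"
  unfolding root_coeff_def
proof (rule the_equality)
  show "\<gamma> = (\<lambda>x. \<Sum>i=1..l. of_int (z i) * \<alpha> i x) \<and> (\<forall>i. i \<notin> {1..l} \<longrightarrow> z i = 0)"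
    using assms by blast
  fix y :: "nat \<Rightarrow> int"
  assume y: "\<gamma> = (\<lambda>x. \<Sum>i=1..l. of_int (y i) * \<alpha> i x) \<and> (\<forall>i. i \<notin> {1..l} \<longrightarrow> y i = 0)"
  have "(\<Sum>i=1..l. (of_int (y i) - of_int (z i)) * \<alpha> i x) = 0" for x
  proof -
    have "(\<Sum>i=1..l. of_int (y i) * \<alpha> i x) = (\<Sum>i=1..l. of_int (z i) * \<alpha> i x)"
      using y assms(1) by metis
    then show ?thesis by (simp add: left_diff_distrib sum_subtractf)
  qed
  then have "of_int (y i) - of_int (z i) = (0 :: 'k)" if "i \<in> {1..l}" for i
    using simple_roots_independent[of "\<lambda>i. of_int (y i) - of_int (z i)"] that by blast
  then have "y i = z i" if "i \<in> {1..l}" for i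
    using that by simp
  then have "y i = z i" for i
    using y assms(2)[of i] by (cases "i \<in> {1..l}") auto
  then show "y = z"
    by blast
qed

lemma weight_expansion:
  assumes "w \<in> weights t"
  shows "w = (\<lambda>x. \<Sum>i=1..l. of_int (root_coeff l \<alpha> w i) * \<alpha> i x)"
    and "(\<forall>i. 0 \<le> root_coeff l \<alpha> w i) \<or> (\<forall>i. root_coeff l \<alpha> w i \<le> 0)"
    and "i \<notin> {1..l} \<Longrightarrow> root_coeff l \<alpha> w i = 0"
proof -
  obtain z :: "nat \<Rightarrow> int" where z: "w = (\<lambda>x. \<Sum>i=1..l. of_int (z i) * \<alpha> i x)"
    "(\<forall>i\<in>{1..l}. 0 \<le> z i) \<or> (\<forall>i\<in>{1..l}. z i \<le> 0)"
  proof (cases "w \<in> roots t")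
    case True
    then show ?thesis using root_expansion that by blast
  next
    case False
    then show ?thesis using assms that[of "\<lambda>_. 0"] by (simp add: weights_def)
  qed
  define y where "y = (\<lambda>i. if i \<in> {1..l} then z i else 0)"
  have y: "w = (\<lambda>x. \<Sum>i=1..l. of_int (y i) * \<alpha> i x)"
    using z(1) by (simp add: y_def)
  have c: "root_coeff l \<alpha> w = y"
    by (rule root_coeff_eqI[OF y]) (auto simp: y_def)
  show "w = (\<lambda>x. \<Sum>i=1..l. of_int (root_coeff l \<alpha> w i) * \<alpha> i x)"
    unfolding c by (rule y)
  show "(\<forall>i. 0 \<le> root_coeff l \<alpha> w i) \<or> (\<forall>i. root_coeff l \<alpha> w i \<le> 0)"
    unfolding c y_def using z(2) by auto
  show "i \<notin> {1..l} \<Longrightarrow> root_coeff l \<alpha> w i = 0"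
    unfolding c y_def by auto
qed

lemma root_coeff_zero: "root_coeff l \<alpha> (\<lambda>_. 0) = (\<lambda>_. 0)"
  by (rule root_coeff_eqI) auto

text \<open>The sum may fail to be a weight, since \<open>root_coeff_eqI\<close> asks only for an
  integral expansion. This generality matters because the no-carry condition is stated for all pairs
  of weights.\<close>

lemma root_coeff_add:
  assumes "\<gamma> \<in> weights t" "\<mu> \<in> weights t"
  shows "root_coeff l \<alpha> (\<lambda>x. \<gamma> x + \<mu> x) = (\<lambda>i. root_coeff l \<alpha> \<gamma> i + root_coeff l \<alpha> \<mu> i)"
proof (rule root_coeff_eqI)
  show "(\<lambda>x. \<gamma> x + \<mu> x) =
      (\<lambda>x. \<Sum>i=1..l. of_int (root_coeff l \<alpha> \<gamma> i + root_coeff l \<alpha> \<mu> i) * \<alpha> i x)"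
  proof
    fix x
    show "\<gamma> x + \<mu> x = (\<Sum>i=1..l. of_int (root_coeff l \<alpha> \<gamma> i + root_coeff l \<alpha> \<mu> i) * \<alpha> i x)"
      using fun_cong[OF weight_expansion(1)[OF assms(1)], of x]
        fun_cong[OF weight_expansion(1)[OF assms(2)], of x]
      by (simp add: distrib_right sum.distrib)
  qed
qed (simp add: weight_expansion(3) assms)

lemma root_coeff_uminus:
  assumes "\<gamma> \<in> weights t"
  shows "root_coeff l \<alpha> (\<lambda>x. - \<gamma> x) = (\<lambda>i. - root_coeff l \<alpha> \<gamma> i)"
proof (rule root_coeff_eqI)
  show "(\<lambda>x. - \<gamma> x) = (\<lambda>x. \<Sum>i=1..l. of_int (- root_coeff l \<alpha> \<gamma> i) * \<alpha> i x)"
  proof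
    fix x
    show "- \<gamma> x = (\<Sum>i=1..l. of_int (- root_coeff l \<alpha> \<gamma> i) * \<alpha> i x)"
      using fun_cong[OF weight_expansion(1)[OF assms(1)], of x] by (simp add: sum_negf)
  qed
qed (simp add: weight_expansion(3) assms)

lemma root_coeff_simple:
  assumes "i \<in> {1..l}"
  shows "root_coeff l \<alpha> (\<alpha> i) = (\<lambda>j. if j = i then 1 else 0)"
proof (rule root_coeff_eqI)
  show "\<alpha> i = (\<lambda>x. \<Sum>j=1..l. of_int (if j = i then 1 else 0) * \<alpha> j x)"
  proof
    fix x
    have "(\<Sum>j=1..l. of_int (if j = i then 1 else 0) * \<alpha> j x) = (\<Sum>j=1..l. if i = j then \<alpha> j x else 0)"
      by (rule sum.cong) auto
    then show "\<alpha> i x = (\<Sum>j=1..l. of_int (if j = i then 1 else 0) * \<alpha> j x)"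
      using assms by simp
  qed
qed (use assms in auto)

lemma kac_degree_zero: "kac_degree l \<alpha> p (\<lambda>_. 0) = 0"
  by (simp add: kac_degree_def root_coeff_zero)

lemma kac_degree_add:
  "\<gamma> \<in> weights t \<Longrightarrow> \<mu> \<in> weights t \<Longrightarrow>
    kac_degree l \<alpha> p (\<lambda>x. \<gamma> x + \<mu> x) = kac_degree l \<alpha> p \<gamma> + kac_degree l \<alpha> p \<mu>"
  by (simp add: kac_degree_def root_coeff_add distrib_right sum.distrib)

lemma kac_degree_uminus:
  "\<gamma> \<in> weights t \<Longrightarrow> kac_degree l \<alpha> p (\<lambda>x. - \<gamma> x) = - kac_degree l \<alpha> p \<gamma>"
  by (simp add: kac_degree_def root_coeff_uminus sum_negf)

lemma kac_degree_simple:
  assumes "i \<in> {1..l}"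
  shows "kac_degree l \<alpha> p (\<alpha> i) = int (p i)"
proof -
  have "kac_degree l \<alpha> p (\<alpha> i) = (\<Sum>j=1..l. if i = j then int (p j) else 0)"
    unfolding kac_degree_def root_coeff_simple[OF assms] by (rule sum.cong) auto
  then show ?thesis using assms by simp
qed

lemma uminus_weight: "w \<in> weights t \<Longrightarrow> (\<lambda>x. - w x) \<in> weights t"
  using uminus_root by (auto simp: weights_def)

text \<open>A nonzero bracket is a vector of the summed weight. Thus the value of a function at a
  sum of weights matters for the contraction only when that sum is a weight.\<close>

lemma br_nonzero_weight_add:
  assumes "\<gamma> \<in> weights t" "\<mu> \<in> weights t" "x \<in> root_space t \<gamma>" "y \<in> root_space t \<mu>" "br x y \<noteq> 0"
  shows "(\<lambda>h. \<gamma> h + \<mu> h) \<in> weights t"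
  using br_in_root_space[OF assms(3,4)] assms dual_add weights_subset_dual
    root_space_eq_zero_if_not_weight by blast

end

section \<open>Kac gradings\<close>

locale kac_grading = based_root_system scale br t l \<alpha>
  for scale :: "'k::field_char_0 \<Rightarrow> 'v::ab_group_add \<Rightarrow> 'v" and br t l \<alpha> +
  fixes \<delta> :: "'v \<Rightarrow> 'k" and p :: "nat \<Rightarrow> nat"
  assumes highest: "highest_root t l \<alpha> \<delta>"
    and order_pos: "0 < kac_order l \<alpha> \<delta> p"
begin

text \<open>For the zero weight the bound says that \<open>\<delta>\<close> has nonnegative
  coefficients, which follows by comparing \<open>\<delta>\<close> with the simple root
  \<open>\<alpha> i\<close>.\<close>

lemma root_coeff_le_highest:
  assumes i: "i \<in> {1..l}" and w: "w \<in> weights t"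
  shows "root_coeff l \<alpha> w i \<le> root_coeff l \<alpha> \<delta> i"
proof (cases "w \<in> roots t")
  case True
  then show ?thesis using highest i by (simp add: highest_root_def)
next
  case False
  then have "root_coeff l \<alpha> w i = 0"
    using w by (simp add: weights_def root_coeff_zero)
  also have "\<dots> \<le> root_coeff l \<alpha> (\<alpha> i) i"
    using i by (simp add: root_coeff_simple)
  also have "\<dots> \<le> root_coeff l \<alpha> \<delta> i"
    using highest i simple_root[OF i] unfolding highest_root_def by blast
  finally show ?thesis .
qed

lemma int_kac_order:
  "int (kac_order l \<alpha> \<delta> p) = int (p 0) + (\<Sum>i=1..l. root_coeff l \<alpha> \<delta> i * int (p i))"
proof -
  \<comment> \<open>Nonnegativity means that the conversion by \<open>nat\<close> in
    \<open>kac_mark\<close> loses nothing.\<close>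
  have "0 \<le> root_coeff l \<alpha> \<delta> i" if "i \<in> {1..l}" for i
    using root_coeff_le_highest[OF that, of "\<lambda>_. 0"] by (simp add: weights_def root_coeff_zero)
  then show ?thesis
    by (simp add: kac_order_def kac_mark_def sum.atLeast_Suc_atMost)
qed

lemma kac_degree_le: "w \<in> weights t \<Longrightarrow> kac_degree l \<alpha> p w \<le> kac_order l \<alpha> \<delta> p - int (p 0)"
  unfolding int_kac_order kac_degree_def
  using root_coeff_le_highest by (auto intro!: sum_mono mult_right_mono)

text \<open>Degree \<open>m\<close> forces \<open>p 0\<close> to vanish and \<open>w\<close> to
  agree with \<open>\<delta>\<close> wherever a label is nonzero. Since the coefficients of a weight
  share one sign, the degree is negative as soon as one coefficient at a nonzero label is. Both
  conditions see \<open>p\<close> only through its zeros.\<close>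

lemma kac_degree_div_order:
  assumes w: "w \<in> weights t"
  shows "kac_degree l \<alpha> p w div kac_order l \<alpha> \<delta> p =
    (if p 0 = 0 \<and> (\<forall>i\<in>{1..l}. p i \<noteq> 0 \<longrightarrow> root_coeff l \<alpha> w i = root_coeff l \<alpha> \<delta> i) then 1
     else if \<exists>i\<in>{1..l}. p i \<noteq> 0 \<and> root_coeff l \<alpha> w i < 0 then - 1 else 0)"
    (is "?d div ?m = (if ?top then 1 else if ?neg then _ else _)")
proof -
  consider (top) ?top | (neg) "\<not> ?top" ?neg | (mid) "\<not> ?top" "\<not> ?neg"
    by blast
  then show ?thesis
  proof cases
    case top
    then have "root_coeff l \<alpha> w i * int (p i) = root_coeff l \<alpha> \<delta> i * int (p i)"
      if "i \<in> {1..l}" for i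
      using that by (cases "p i = 0") auto
    then have "?d = (\<Sum>i=1..l. root_coeff l \<alpha> \<delta> i * int (p i))"
      unfolding kac_degree_def by (intro sum.cong refl)
    then have "?d = ?m"
      using top by (simp add: int_kac_order)
    then show ?thesis
      using top order_pos by simp
  next
    case neg
    then obtain i where i: "i \<in> {1..l}" "p i \<noteq> 0" "root_coeff l \<alpha> w i < 0"
      by blast
    then have "\<forall>j. root_coeff l \<alpha> w j \<le> 0"
      using weight_expansion(2)[OF w] by (meson not_le)
    then have "?d < (\<Sum>i=1..l. 0)"
      unfolding kac_degree_def using i
      by (intro sum_strict_mono_ex1) (auto simp: mult_nonpos_nonneg mult_neg_pos intro!: bexI[of _ i])
    \<comment> \<open>The lower bound is the upper bound for the opposite weight.\<close>
    moreover have "- ?d \<le> ?m"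
      using kac_degree_le[OF uminus_weight[OF w]] kac_degree_uminus[OF w] by simp
    \<comment> \<open>Adding \<open>m\<close> moves the degree from the range -m, ..., -1 to 0, ...,
      m - 1.\<close>
    ultimately have "(?d + ?m) div ?m = 0"
      by (intro div_pos_pos_trivial) auto
    then have "?d div ?m = - 1"
      using order_pos by simp
    then show ?thesis
      using neg by auto
  next
    case mid
    \<comment> \<open>Strictness comes from \<open>p 0\<close> if it is nonzero, and otherwise from
      a nonzero label at which \<open>w\<close> stays below \<open>\<delta>\<close>.\<close>
    have "?d < ?m"
    proof (cases "p 0 = 0")
      case True
      then obtain i where i: "i \<in> {1..l}" "p i \<noteq> 0" "root_coeff l \<alpha> w i \<noteq> root_coeff l \<alpha> \<delta> i"
        using mid by blast
      then have "root_coeff l \<alpha> w i * int (p i) < root_coeff l \<alpha> \<delta> i * int (p i)"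
        using root_coeff_le_highest[OF i(1) w] by simp
      then have "?d < (\<Sum>i=1..l. root_coeff l \<alpha> \<delta> i * int (p i))"
        unfolding kac_degree_def using i(1) root_coeff_le_highest w
        by (intro sum_strict_mono_ex1) (auto intro!: mult_right_mono)
      then show ?thesis
        by (simp add: int_kac_order)
    next
      case False
      then show ?thesis using kac_degree_le[OF w] by simp
    qed
    moreover have "0 \<le> ?d"
      unfolding kac_degree_def
    proof (rule sum_nonneg)
      fix i assume i: "i \<in> {1..l}"
      have "0 \<le> root_coeff l \<alpha> w i" if "p i \<noteq> 0"
        using mid(2) i that not_less by blast
      then show "0 \<le> root_coeff l \<alpha> w i * int (p i)"
        by (cases "p i = 0") auto
    qed
    ultimately show ?thesis
      using mid by (auto simp: div_pos_pos_trivial)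
  qed
qed

end

section \<open>Powers of primitive roots of unity and carries modulo m\<close>

lemma primitive_root_power_eq_1_iff:
  assumes "primitive_root_of_unity m \<zeta>"
  shows "\<zeta> ^ k = 1 \<longleftrightarrow> m dvd k"
proof -
  have m: "0 < m" "\<zeta> ^ m = 1" and min: "\<And>j. 0 < j \<Longrightarrow> j < m \<Longrightarrow> \<zeta> ^ j \<noteq> 1"
    using assms by (auto simp: primitive_root_of_unity_def)
  have "\<zeta> ^ k = (\<zeta> ^ m) ^ (k div m) * \<zeta> ^ (k mod m)"
    by (simp flip: power_mult power_add)
  then have "\<zeta> ^ k = \<zeta> ^ (k mod m)"
    using m by simp
  then show ?thesis
    using min[of "k mod m"] m(1) by (auto simp: dvd_eq_mod_eq_0)
qed

lemma primitive_root_power_inj: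
  assumes \<zeta>: "primitive_root_of_unity m \<zeta>" and "i < m" "j < m" "\<zeta> ^ i = \<zeta> ^ j"
  shows "i = j"
proof -
  have "\<zeta> \<noteq> 0"
    using \<zeta> by (auto simp: primitive_root_of_unity_def power_0_left)
  then have "m dvd j - i" if "i \<le> j" "\<zeta> ^ i = \<zeta> ^ j" for i j
  proof -
    have "\<zeta> ^ i * \<zeta> ^ (j - i) = \<zeta> ^ j"
      using that(1) by (simp flip: power_add)
    then have "\<zeta> ^ i * \<zeta> ^ (j - i) = \<zeta> ^ i * 1"
      using that(2) by simp
    then show ?thesis
      using \<open>\<zeta> \<noteq> 0\<close> primitive_root_power_eq_1_iff[OF \<zeta>] by simp
  qed
  then have "j \<le> i" if "i \<le> j" "j < m" "\<zeta> ^ i = \<zeta> ^ j" for i j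
    using that nat_dvd_not_less[of "j - i" m] by fastforce
  from this[of i j] this[of j i] show ?thesis
    using assms(2-4) by (metis antisym nat_le_linear)
qed

lemma primitive_root_powi:
  assumes "primitive_root_of_unity m \<zeta>"
  shows "\<zeta> powi d = \<zeta> ^ nat (d mod int m)"
proof -
  have m: "0 < m" "\<zeta> ^ m = 1" "\<zeta> \<noteq> 0"
    using assms by (auto simp: primitive_root_of_unity_def power_0_left)
  have "\<zeta> powi d = \<zeta> powi (int m * (d div int m) + int (nat (d mod int m)))"
    using m(1) by simp
  also have "\<dots> = \<zeta> ^ nat (d mod int m)"
    using m(2,3) by (simp del: nat_0_le int_nat_eq add: power_int_add power_int_mult power_int_of_nat)
  finally show ?thesis .
qed

text \<open>The quotient of the sum exceeds the sum of the quotients by the carry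
  \<open>(a mod m + b mod m) div m\<close>, which is zero exactly when the residues add up to less
  than \<open>m\<close>.\<close>

lemma mod_add_mod_less_iff:
  fixes a b m :: int
  assumes "0 < m"
  shows "a mod m + b mod m \<le> m - 1 \<longleftrightarrow> a div m + b div m = (a + b) div m"
proof -
  have "(a + b) div m = a div m + b div m + (a mod m + b mod m) div m"
    by (rule div_add1_eq)
  moreover have "(a mod m + b mod m) div m = 0 \<longleftrightarrow> a mod m + b mod m < m"
    using assms pos_mod_sign[OF assms, of a] pos_mod_sign[OF assms, of b]
    by (auto simp: zdiv_eq_0_iff)
  ultimately show ?thesis by linarith
qed

section \<open>Contractions\<close>

context lie_algebra
begin

definition bilinear_map :: "('v \<Rightarrow> 'v \<Rightarrow> 'v) \<Rightarrow> bool" where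
  "bilinear_map B \<longleftrightarrow> (\<forall>y. Vector_Spaces.linear scale scale (\<lambda>x. B x y)) \<and>
     (\<forall>x. Vector_Spaces.linear scale scale (\<lambda>y. B x y))"

interpretation endo: vector_space_pair scale scale
  by unfold_locales

lemma bilinear_map_eq_on_span:
  assumes B: "bilinear_map B" and C: "bilinear_map C"
    and eq: "\<And>x y. x \<in> S \<Longrightarrow> y \<in> T \<Longrightarrow> B x y = C x y"
    and "x \<in> span S" "y \<in> span T"
  shows "B x y = C x y"
proof -
  have "B x y = C x y" if "x \<in> S" for x
    using endo.linear_eq_on_span[of "B x" "C x" T y] B C eq that \<open>y \<in> span T\<close>
    by (simp add: bilinear_map_def)
  then show ?thesis
    using endo.linear_eq_on_span[of "\<lambda>x. B x y" "\<lambda>x. C x y" S x] B C \<open>x \<in> span S\<close>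
    by (simp add: bilinear_map_def)
qed

text \<open>The specification of the contraction, tested on weight vectors instead of homogeneous
  ones, with the absence of a carry as additivity of \<open>q\<close>. The automorphism and the root
  of unity no longer occur.\<close>

definition contraction_map :: "'v set \<Rightarrow> (('v \<Rightarrow> 'k) \<Rightarrow> int) \<Rightarrow> ('v \<Rightarrow> 'v \<Rightarrow> 'v) \<Rightarrow> bool" where
  "contraction_map t q B \<longleftrightarrow> bilinear_map B \<and>
     (\<forall>\<gamma>\<in>weights t. \<forall>\<mu>\<in>weights t. \<forall>x\<in>root_space t \<gamma>. \<forall>y\<in>root_space t \<mu>.
        B x y = (if q \<gamma> + q \<mu> = q (\<lambda>h. \<gamma> h + \<mu> h) then br x y else 0))"

end

section \<open>Order, grades and contraction of a Kac automorphism\<close>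

locale kac_automorphism = kac_grading scale br t l \<alpha> \<delta> p
  for scale :: "'k::field_char_0 \<Rightarrow> 'v::ab_group_add \<Rightarrow> 'v" and br t l \<alpha> \<delta> p +
  fixes \<zeta> :: 'k and \<theta> :: "'v \<Rightarrow> 'v"
  assumes labels: "kac_labels l p"
    and primitive: "primitive_root_of_unity (kac_order l \<alpha> \<delta> p) \<zeta>"
    and automorphism: "is_kac_automorphism t l \<alpha> \<zeta> p \<theta>"
begin

interpretation endo: vector_space_pair scale scale
  by unfold_locales

abbreviation "m \<equiv> kac_order l \<alpha> \<delta> p"

definition residue :: "('v \<Rightarrow> 'k) \<Rightarrow> nat" where
  "residue w = nat (kac_degree l \<alpha> p w mod int m)"

lemma residue_less: "residue w < m"
  using order_pos by (simp add: residue_def nat_less_iff)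

lemma int_residue: "int (residue w) = kac_degree l \<alpha> p w mod int m"
  using order_pos by (simp add: residue_def)

lemma linear_automorphism: "Vector_Spaces.linear scale scale \<theta>"
  using automorphism by (simp add: is_kac_automorphism_def lie_automorphism_def)

lemma automorphism_on_weight_space:
  assumes "w \<in> weights t" "x \<in> root_space t w"
  shows "\<theta> x = scale (\<zeta> ^ residue w) x"
proof -
  have "\<theta> x = scale (\<zeta> powi kac_degree l \<alpha> p w) x"
  proof (cases "w \<in> roots t")
    case True
    then show ?thesis using automorphism assms by (simp add: is_kac_automorphism_def)
  next
    case False
    then have w: "w = (\<lambda>_. 0)" using assms by (simp add: weights_def)
    then have "x \<in> t" using assms root_space_zero[OF cartan] by simp
    then show ?thesis
      using automorphism by (simp add: w kac_degree_zero is_kac_automorphism_def)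
  qed
  then show ?thesis by (simp add: residue_def primitive_root_powi[OF primitive])
qed

lemma automorphism_power_on_weight_space:
  assumes "w \<in> weights t" "x \<in> root_space t w"
  shows "(\<theta> ^^ n) x = scale (\<zeta> ^ (n * residue w)) x"
proof (induction n)
  case 0
  show ?case by simp
next
  case (Suc n)
  have "(\<theta> ^^ Suc n) x = scale (\<zeta> ^ (n * residue w)) (\<theta> x)"
    by (simp add: Suc endo.linear_scale[OF linear_automorphism])
  also have "\<dots> = scale (\<zeta> ^ (n * residue w + residue w)) x"
    by (simp only: automorphism_on_weight_space[OF assms] scale_scale power_add)
  finally show ?case
    by (simp only: mult_Suc add.commute)
qed

text \<open>Vectors of simple roots show that \<open>m\<close> divides \<open>n * p i\<close> for
  positive \<open>i\<close>. The formula for \<open>m\<close> extends this to \<open>p 0\<close>,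
  and the labels are coprime. With \<open>power_order_eq_id\<close> this makes \<open>m\<close> the
  exact order.\<close>

lemma order_dvd_if_power_eq_id:
  assumes "\<theta> ^^ n = id"
  shows "m dvd n"
proof -
  have simple: "m dvd n * p i" if i: "i \<in> {1..l}" for i
  proof -
    have w: "\<alpha> i \<in> weights t" using simple_root[OF i] by (simp add: weights_def)
    obtain x where x: "x \<in> root_space t (\<alpha> i)" "x \<noteq> 0"
      using simple_root[OF i] subspace_0[OF subspace_root_space] by (auto simp: roots_def)
    have "scale (\<zeta> ^ (n * residue (\<alpha> i)) - 1) x = 0"
      using automorphism_power_on_weight_space[OF w x(1), of n] assms
      by (simp add: scale_left_diff_distrib)
    then have "m dvd n * residue (\<alpha> i)"
      using x(2) primitive_root_power_eq_1_iff[OF primitive] by simp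
    moreover have "residue (\<alpha> i) = p i mod m"
      using i by (simp add: residue_def kac_degree_simple nat_mod_distrib)
    ultimately show ?thesis
      by (simp add: dvd_eq_mod_eq_0 mod_mult_right_eq)
  qed
  \<comment> \<open>No simple root carries the label \<open>p 0\<close>; it is reached as the
    difference between \<open>m\<close> and the marked sum of the other labels.\<close>
  have "n * m = n * p 0 + (\<Sum>i=1..l. kac_mark l \<alpha> \<delta> i * (n * p i))"
    by (simp add: kac_order_def kac_mark_def sum.atLeast_Suc_atMost distrib_left sum_distrib_left
        mult.left_commute)
  moreover have "m dvd (\<Sum>i=1..l. kac_mark l \<alpha> \<delta> i * (n * p i))"
    using simple by (intro dvd_sum dvd_mult[OF simple])
  ultimately have "m dvd n * p 0"
    by (metis dvd_add_left_iff dvd_triv_right)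
  then have "m dvd n * p i" if "i \<in> {0..l}" for i
    using simple[of i] that by (cases "i = 0") auto
  \<comment> \<open>The labels have gcd 1, so the products \<open>n * p i\<close> have gcd
    \<open>n\<close>.\<close>
  then have "m dvd Gcd ((*) n ` p ` {0..l})"
    by (intro Gcd_greatest) auto
  then show ?thesis
    using labels by (simp add: Gcd_mult kac_labels_def)
qed

lemma power_order_eq_id: "\<theta> ^^ m = id"
proof
  fix x
  have lin: "Vector_Spaces.linear scale scale (\<theta> ^^ n)" for n
  proof (induction n)
    case 0
    show ?case unfolding funpow.simps(1) by (rule linear_id)
  next
    case (Suc n)
    from Vector_Spaces.linear_compose[OF this linear_automorphism] show ?case
      unfolding funpow.simps(2) .
  qed
  show "(\<theta> ^^ m) x = id x"
  proof (rule endo.linear_eq_on_span[OF lin linear_id])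
    show "x \<in> span (\<Union>\<gamma>\<in>weights t. root_space t \<gamma>)"
      using weight_spaces_span[OF cartan] by simp
    fix y assume "y \<in> (\<Union>\<gamma>\<in>weights t. root_space t \<gamma>)"
    then obtain w where "w \<in> weights t" "y \<in> root_space t w"
      by blast
    from automorphism_power_on_weight_space[OF this, of m] show "(\<theta> ^^ m) y = id y"
      using primitive_root_power_eq_1_iff[OF primitive, of "m * residue w"] by simp
  qed
qed

lemma map_order_eq: "map_order \<theta> = m"
  unfolding map_order_def
proof (rule Least_equality)
  show "0 < m \<and> \<theta> ^^ m = id"
    using order_pos power_order_eq_id by blast
  show "m \<le> n" if "0 < n \<and> \<theta> ^^ n = id" for n
    using that order_dvd_if_power_eq_id by (blast intro: dvd_imp_le)
qed

definition quotient :: "('v \<Rightarrow> 'k) \<Rightarrow> int" where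
  "quotient w = kac_degree l \<alpha> p w div int m"

lemma residue_sum_le_iff:
  assumes "\<gamma> \<in> weights t" "\<mu> \<in> weights t"
  shows "residue \<gamma> + residue \<mu> \<le> m - 1 \<longleftrightarrow>
    quotient \<gamma> + quotient \<mu> = quotient (\<lambda>h. \<gamma> h + \<mu> h)"
proof -
  \<comment> \<open>Natural subtraction in \<open>m - 1\<close> agrees with the integer one because
    \<open>m\<close> is positive.\<close>
  have "residue \<gamma> + residue \<mu> \<le> m - 1 \<longleftrightarrow> int (residue \<gamma>) + int (residue \<mu>) \<le> int m - 1"
    using order_pos by linarith
  moreover have "0 < int m"
    using order_pos by simp
  ultimately show ?thesis
    unfolding int_residue quotient_def kac_degree_add[OF assms] by (simp only: mod_add_mod_less_iff)
qed

text \<open>\<open>\<theta>\<close> is scalar on each weight space, and different residues below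
  \<open>m\<close> give different powers of \<open>\<zeta>\<close>. So an eigenvector with
  eigenvalue \<open>\<zeta> ^ i\<close> involves only weights of residue \<open>i\<close>.\<close>

lemma grade_eq_span:
  assumes "i < m"
  shows "grade \<zeta> \<theta> i = span (\<Union>w\<in>{w \<in> weights t. residue w = i}. root_space t w)"
    (is "_ = span ?S")
proof
  let ?W = "\<Union>w\<in>weights t. root_space t w"
  show "grade \<zeta> \<theta> i \<subseteq> span ?S"
  proof
    fix x assume "x \<in> grade \<zeta> \<theta> i"
    then have "x \<in> span {s \<in> ?W. \<theta> s = scale (\<zeta> ^ i) s}"
      using automorphism_on_weight_space weight_spaces_span[OF cartan]
      by (intro eigenspace_subset_span[OF linear_automorphism]) (auto simp: grade_def)
    also have "\<dots> \<subseteq> span ?S"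
    proof (rule span_minimal)
      show "{s \<in> ?W. \<theta> s = scale (\<zeta> ^ i) s} \<subseteq> span ?S"
      proof clarify
        fix s w assume w: "w \<in> weights t" and s: "s \<in> root_space t w" "\<theta> s = scale (\<zeta> ^ i) s"
        \<comment> \<open>The zero vector lies in every weight space and determines no residue, so
          it is treated apart.\<close>
        show "s \<in> span ?S"
        proof (cases "s = 0")
          case False
          have "scale (\<zeta> ^ residue w) s = scale (\<zeta> ^ i) s"
            using s(2) by (simp only: automorphism_on_weight_space[OF w s(1)])
          then have "residue w = i"
            using False primitive_root_power_inj[OF primitive residue_less assms] by simp
          then show ?thesis using w s by (intro span_base) blast
        qed (simp add: span_zero)
      qed
    qed simp
    finally show "x \<in> span ?S" .
  qed
  have "subspace (grade \<zeta> \<theta> i)"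
    by (auto simp: subspace_def grade_def endo.linear_0[OF linear_automorphism]
        endo.linear_add[OF linear_automorphism] endo.linear_scale[OF linear_automorphism]
        scale_right_distrib mult.commute)
  then show "span ?S \<subseteq> grade \<zeta> \<theta> i"
    using automorphism_on_weight_space by (intro span_minimal) (auto simp: grade_def)
qed

text \<open>A weight space lies in the grade of its residue, which gives one direction between the
  two specifications. Conversely a grade is spanned by its weight spaces, so bilinearity extends the
  values from them to the grade.\<close>

lemma contraction_eq: "contraction \<zeta> \<theta> = (THE B. contraction_map t quotient B)"
proof -
  have iff: "(\<forall>i<m. \<forall>j<m. \<forall>x\<in>grade \<zeta> \<theta> i. \<forall>y\<in>grade \<zeta> \<theta> j.
        B x y = (if i + j \<le> m - 1 then br x y else 0)) \<longleftrightarrow>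
      (\<forall>\<gamma>\<in>weights t. \<forall>\<mu>\<in>weights t. \<forall>x\<in>root_space t \<gamma>. \<forall>y\<in>root_space t \<mu>.
        B x y = (if quotient \<gamma> + quotient \<mu> = quotient (\<lambda>h. \<gamma> h + \<mu> h) then br x y else 0))"
    (is "?grades \<longleftrightarrow> ?weights") if B: "bilinear_map B" for B
  proof
    assume grades: ?grades
    show ?weights
    proof (intro ballI)
      fix \<gamma> \<mu> x y
      assume w: "\<gamma> \<in> weights t" "\<mu> \<in> weights t" "x \<in> root_space t \<gamma>" "y \<in> root_space t \<mu>"
      have "x \<in> grade \<zeta> \<theta> (residue \<gamma>)" "y \<in> grade \<zeta> \<theta> (residue \<mu>)"
        using automorphism_on_weight_space w by (auto simp: grade_def)
      then have "B x y = (if residue \<gamma> + residue \<mu> \<le> m - 1 then br x y else 0)"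
        using grades residue_less by blast
      then show "B x y = (if quotient \<gamma> + quotient \<mu> = quotient (\<lambda>h. \<gamma> h + \<mu> h) then br x y else 0)"
        unfolding residue_sum_le_iff[OF w(1,2)] .
    qed
  next
    assume weights: ?weights
    show ?grades
    proof (intro allI impI ballI)
      fix i j x y
      assume ij: "i < m" "j < m" and x: "x \<in> grade \<zeta> \<theta> i" and y: "y \<in> grade \<zeta> \<theta> j"
      \<comment> \<open>For fixed \<open>i\<close> and \<open>j\<close> the condition does not
        involve \<open>x\<close> and \<open>y\<close>, so the right-hand side is the bracket or zero
        throughout.\<close>
      have "bilinear_map (\<lambda>x y. if i + j \<le> m - 1 then br x y else 0)"
        using br_linear_left br_linear_right endo.linear_zero
        by (cases "i + j \<le> m - 1") (simp_all add: bilinear_map_def)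
      moreover have "B x y = (if i + j \<le> m - 1 then br x y else 0)"
        if x: "x \<in> (\<Union>w\<in>{w \<in> weights t. residue w = i}. root_space t w)"
          and y: "y \<in> (\<Union>w\<in>{w \<in> weights t. residue w = j}. root_space t w)" for x y
      proof -
        obtain \<gamma> \<mu> where w: "\<gamma> \<in> weights t" "\<mu> \<in> weights t" and res: "residue \<gamma> = i" "residue \<mu> = j"
          and "x \<in> root_space t \<gamma>" "y \<in> root_space t \<mu>"
          using x y by blast
        then have "B x y =
            (if quotient \<gamma> + quotient \<mu> = quotient (\<lambda>h. \<gamma> h + \<mu> h) then br x y else 0)"
          using weights by blast
        then show ?thesis
          unfolding residue_sum_le_iff[OF w, symmetric] res .
      qed
      ultimately show "B x y = (if i + j \<le> m - 1 then br x y else 0)"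
        by (rule bilinear_map_eq_on_span[OF B _ _ x[unfolded grade_eq_span[OF ij(1)]]
              y[unfolded grade_eq_span[OF ij(2)]]])
    qed
  qed
  have "(\<forall>y. Vector_Spaces.linear scale scale (\<lambda>x. B x y)) \<and>
      (\<forall>x. Vector_Spaces.linear scale scale (\<lambda>y. B x y)) \<and>
      (\<forall>i<m. \<forall>j<m. \<forall>x\<in>grade \<zeta> \<theta> i. \<forall>y\<in>grade \<zeta> \<theta> j.
        B x y = (if i + j \<le> m - 1 then br x y else 0)) \<longleftrightarrow>
      contraction_map t quotient B" for B
    unfolding contraction_map_def bilinear_map_def conj_assoc
    by (intro conj_cong refl iff[unfolded bilinear_map_def] conjI)
  \<comment> \<open>The defining predicates coincide, so existence and uniqueness play no role.\<close>
  then show ?thesis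
    unfolding contraction_def map_order_eq by (simp only:)
qed

end

section \<open>Comparison of two tuples of labels\<close>

text \<open>The functions may differ at \<open>\<gamma> + \<mu>\<close> if that is not a weight, but
  then the bracket is zero and both branches of the conditional agree.\<close>

lemma (in based_root_system) contraction_map_cong:
  assumes "\<And>w. w \<in> weights t \<Longrightarrow> q w = q' w"
  shows "contraction_map t q B \<longleftrightarrow> contraction_map t q' B"
proof -
  have "(if q \<gamma> + q \<mu> = q (\<lambda>h. \<gamma> h + \<mu> h) then br x y else 0) =
      (if q' \<gamma> + q' \<mu> = q' (\<lambda>h. \<gamma> h + \<mu> h) then br x y else 0)"
    if "\<gamma> \<in> weights t" "\<mu> \<in> weights t" "x \<in> root_space t \<gamma>" "y \<in> root_space t \<mu>" for \<gamma> \<mu> x y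
    using br_nonzero_weight_add[OF that] assms that by (cases "br x y = 0") auto
  then show ?thesis
    unfolding contraction_map_def by (simp cong: ball_cong)
qed

theorem theorem4p7:
  fixes scale :: "'k::{alg_closed_field, field_char_0} \<Rightarrow> 'v::ab_group_add \<Rightarrow> 'v"
    and br :: "'v \<Rightarrow> 'v \<Rightarrow> 'v"
    and t :: "'v set"
    and l :: nat
    and \<alpha> :: "nat \<Rightarrow> 'v \<Rightarrow> 'k"
    and \<delta> :: "'v \<Rightarrow> 'k"
    and p p' :: "nat \<Rightarrow> nat"
    and \<zeta> \<zeta>' :: 'k
    and \<theta> \<theta>' :: "'v \<Rightarrow> 'v"
  assumes "simple_lie_algebra scale br"
    and "lie_algebra.cartan_subalgebra scale br t"
    and "l = vector_space.dim scale t"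
    and "lie_algebra.simple_roots scale br t l \<alpha>"
    and "lie_algebra.highest_root scale br t l \<alpha> \<delta>"
    and "kac_labels l p" and "kac_labels l p'"
    and "primitive_root_of_unity (lie_algebra.kac_order l \<alpha> \<delta> p) \<zeta>"
    and "primitive_root_of_unity (lie_algebra.kac_order l \<alpha> \<delta> p') \<zeta>'"
    and "lie_algebra.is_kac_automorphism scale br t l \<alpha> \<zeta> p \<theta>"
    and "lie_algebra.is_kac_automorphism scale br t l \<alpha> \<zeta>' p' \<theta>'"
    and "{i \<in> {0..l}. p i \<noteq> 0} = {i \<in> {0..l}. p' i \<noteq> 0}"
  shows "lie_algebra.contraction scale br \<zeta> \<theta> = lie_algebra.contraction scale br \<zeta>' \<theta>'"
proof -
  interpret simple_lie_algebra scale br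
    by (rule assms(1))
  interpret based_root_system scale br t l \<alpha>
    by unfold_locales (use assms in auto)
  \<comment> \<open>Positivity of the order is contained in \<open>primitive_root_of_unity\<close>,
    whose definition is unfolded for this purpose.\<close>
  interpret P: kac_automorphism scale br t l \<alpha> \<delta> p \<zeta> \<theta>
    by unfold_locales (use assms in \<open>auto simp: primitive_root_of_unity_def\<close>)
  interpret P': kac_automorphism scale br t l \<alpha> \<delta> p' \<zeta>' \<theta>'
    by unfold_locales (use assms in \<open>auto simp: primitive_root_of_unity_def\<close>)
  have support: "p i = 0 \<longleftrightarrow> p' i = 0" if "i \<le> l" for i
    using eqset_imp_iff[OF assms(12), of i] that by auto
  \<comment> \<open>Both quotients are given by the same case distinction, in which labels enter
    only through their vanishing.\<close>
  have "P.quotient w = P'.quotient w" if "w \<in> weights t" for w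
    unfolding P.quotient_def P'.quotient_def
      P.kac_degree_div_order[OF that] P'.kac_degree_div_order[OF that]
    using support by (intro if_cong conj_cong ball_cong bex_cong) auto
  then have "contraction_map t P.quotient = contraction_map t P'.quotient"
    using contraction_map_cong by blast
  then show ?thesis
    unfolding P.contraction_eq P'.contraction_eq by simp
qed

end
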